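(* Let $A\in\mathbb{R}^{n\times n}$, $b\in\mathbb{R}^n$ and let $D\subset\mathbb{N}$ be a finite set of delays. Suppose that $A$ has one Jordan block with eigenvalue zero (exactly one), of size $k$; that is, there is an invertible matrix $T$ such that $$TAT^{-1}=\begin{pmatrix} J_{0,k} & 0 \\ 0 & A' \end{pmatrix},\qquad Tb=\begin{pmatrix} b_0 \\ b' \end{pmatrix},$$ where $J_{0,k}$ is the $k\times k$ Jordan block with eigenvalue $0$ and $A'$ is invertible. Then the linear system with switched delays $(A,b,D)$ is uncontrollable if and only if the system $(J_{0,k},b_0)$ is uncontrollable with the set of delays $D$, or the system $(A',b')$ is uncontrollable with the set of delays $D$.
   Context: Linear system with switched delays $(A,b,D)$ (single input): $x(t+1)=Ax(t)+b\sum_{0\le t'\le t:\ t'+\sigma(t')=t}v(t')$, with $\sigma:\mathbb{N}\to D$ and $v(t)\in\mathbb{R}$. Controllability is with arbitrarily large look-ahead, i.e. the controller may use knowledge of the whole signal $\sigma$. The system is controllable if for every $x_0$, $x_f$ and $\sigma$ there is a control signal $v$ and a $t\ge0$ such that $x(0)=x_0$ implies $x(t)=x_f$. Equivalently, it is uncontrollable iff there is a switching signal $\sigma$ such that for all $t\in\mathbb{N}$ the columns $\{A^{t-t'-\sigma(t')}b:\ t'\ge0,\ t-t'-\sigma(t')\ge0\}$ of the controllability matrix $C_t$ do not span the whole state space. The same definition is used for the pairs $(J_{0,k},b_0)$ and $(A',b')$ in their respective dimensions. *)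

theory Defs
  imports "Jordan_Normal_Form.Jordan_Normal_Form"
begin

primrec switched_state ::
  "real mat \<Rightarrow> real vec \<Rightarrow> (nat \<Rightarrow> nat) \<Rightarrow> (nat \<Rightarrow> real) \<Rightarrow> real vec \<Rightarrow> nat \<Rightarrow> real vec"
where
  "switched_state A b \<sigma> v x0 0 = x0"
| "switched_state A b \<sigma> v x0 (Suc t) =
     A *\<^sub>v switched_state A b \<sigma> v x0 t + (\<Sum>t' | t' \<le> t \<and> t' + \<sigma> t' = t. v t') \<cdot>\<^sub>v b"

text \<open>
  The control signal and the final time are chosen after the whole switching signal is known,
  i.e. the look-ahead is arbitrarily large. In dimension 0 the system is trivially controllable.
\<close>

definition switched_controllable :: "nat \<Rightarrow> real mat \<Rightarrow> real vec \<Rightarrow> nat set \<Rightarrow> bool" where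
  "switched_controllable n A b D \<longleftrightarrow>
     (\<forall>x0 \<in> carrier_vec n. \<forall>xf \<in> carrier_vec n. \<forall>\<sigma>. range \<sigma> \<subseteq> D \<longrightarrow>
        (\<exists>v t. switched_state A b \<sigma> v x0 t = xf))"

end

theory Submission imports Defs
begin

text \<open>
  Only the set \<open>P\<close> of arrival times \<open>t' + \<sigma> t'\<close> matters: the inputs that can be realised are exactly
  those supported on \<open>P\<close>. For the invertible part, steering every state to zero is possible by a
  time \<open>s\<close> that does not depend on the state, because a state that has reached zero can stay
  there. For the nilpotent part, controllability forces \<open>k\<close> consecutive times into \<open>P\<close>; applied to
  the signal shifted by \<open>s\<close>, it yields such a window after \<open>s\<close>. Inputs in that window fix the
  nilpotent component whatever happened before, and their effect on the invertible component is
  compensated in advance by inputs before \<open>s\<close>.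
\<close>

section \<open>Inputs indexed by arrival time\<close>

definition arrivals :: "(nat \<Rightarrow> nat) \<Rightarrow> nat set" where
  "arrivals \<sigma> = range (\<lambda>t. t + \<sigma> t)"

text \<open>Indexing the input by arrival time instead of sending time removes the delays from the
  recursion; they survive only as a condition on the support of \<open>w\<close>.\<close>

primrec driven_state ::
  "real mat \<Rightarrow> real vec \<Rightarrow> (nat \<Rightarrow> real) \<Rightarrow> real vec \<Rightarrow> nat \<Rightarrow> real vec"
where
  "driven_state A b w x 0 = x"
| "driven_state A b w x (Suc t) = A *\<^sub>v driven_state A b w x t + w t \<cdot>\<^sub>v b"

lemma switched_state_eq_driven_state:
  "switched_state A b \<sigma> v x t =
   driven_state A b (\<lambda>p. \<Sum>t' | t' \<le> p \<and> t' + \<sigma> t' = p. v t') x t"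
  by (induction t) auto

text \<open>Values that arrive together are added, so one of them can carry all of
  \<open>w p\<close> while the others are 0.\<close>

lemma realise_input:
  assumes "\<And>p. w p \<noteq> 0 \<Longrightarrow> p \<in> arrivals \<sigma>"
  obtains v :: "nat \<Rightarrow> real" where "\<And>p. (\<Sum>t' | t' \<le> p \<and> t' + \<sigma> t' = p. v t') = w p"
proof
  \<comment> \<open>The carrier chosen for \<open>p\<close> is the earliest sending time. Off
    \<open>arrivals \<sigma>\<close> the value \<open>r p\<close> is unspecified, but the sum is
    then empty.\<close>
  define r where "r p = (LEAST s. s + \<sigma> s = p)" for p
  fix p
  let ?S = "{t'. t' \<le> p \<and> t' + \<sigma> t' = p}"
  let ?v = "\<lambda>t'. if t' = r (t' + \<sigma> t') then w (t' + \<sigma> t') else 0"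
  show "(\<Sum>t'\<in>?S. ?v t') = w p"
  proof (cases "p \<in> arrivals \<sigma>")
    case True
    then have "\<exists>s. s + \<sigma> s = p" by (auto simp: arrivals_def)
    then have "r p + \<sigma> (r p) = p" unfolding r_def by (rule LeastI_ex)
    then have "r p \<in> ?S" by auto
    have "(\<Sum>t'\<in>?S. ?v t') = (\<Sum>t'\<in>?S. if t' = r p then w p else 0)"
      by (rule sum.cong) auto
    also have "\<dots> = w p" using \<open>r p \<in> ?S\<close> by (subst sum.delta) auto
    finally show ?thesis .
  next
    case False
    then have "?S = {}" by (auto simp: arrivals_def)
    then show ?thesis using assms[of p] False by (simp only: sum.empty) auto
  qed
qed

lemma switched_controllable_iff_driven:
  "switched_controllable n A b D \<longleftrightarrow>
     (\<forall>x0 \<in> carrier_vec n. \<forall>xf \<in> carrier_vec n. \<forall>\<sigma>. range \<sigma> \<subseteq> D \<longrightarrow>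
        (\<exists>w t. (\<forall>p. w p \<noteq> 0 \<longrightarrow> p \<in> arrivals \<sigma>) \<and> driven_state A b w x0 t = xf))"
proof -
  have "(\<exists>v. switched_state A b \<sigma> v x0 t = xf) \<longleftrightarrow>
        (\<exists>w. (\<forall>p. w p \<noteq> 0 \<longrightarrow> p \<in> arrivals \<sigma>) \<and> driven_state A b w x0 t = xf)"
    (is "?L \<longleftrightarrow> ?R") for \<sigma> x0 xf t
  proof
    assume ?L
    then obtain v where v: "switched_state A b \<sigma> v x0 t = xf" by blast
    have "p \<in> arrivals \<sigma>" if "(\<Sum>t' | t' \<le> p \<and> t' + \<sigma> t' = p. v t') \<noteq> 0" for p
    proof -
      have "{t'. t' \<le> p \<and> t' + \<sigma> t' = p} \<noteq> {}" using that by (metis sum.empty)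
      then show ?thesis by (auto simp: arrivals_def)
    qed
    then show ?R using v unfolding switched_state_eq_driven_state
      by (intro exI[of _ "\<lambda>p. \<Sum>t' | t' \<le> p \<and> t' + \<sigma> t' = p. v t'"]) auto
  next
    assume ?R
    then obtain w where w: "\<And>p. w p \<noteq> 0 \<Longrightarrow> p \<in> arrivals \<sigma>" "driven_state A b w x0 t = xf"
      by blast
    obtain v where "\<And>p. (\<Sum>t' | t' \<le> p \<and> t' + \<sigma> t' = p. v t') = w p"
      using realise_input[of w \<sigma>] w(1) by blast
    then show ?L using w(2) unfolding switched_state_eq_driven_state by (intro exI[of _ v]) simp
  qed
  then show ?thesis unfolding switched_controllable_def by metis
qed

section \<open>Linearity and concatenation of trajectories\<close>

lemma driven_state_carrier [simp]:
  assumes "A \<in> carrier_mat n n" "b \<in> carrier_vec n" "x \<in> carrier_vec n"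
  shows "driven_state A b w x t \<in> carrier_vec n"
  using assms by (induction t) auto

lemma driven_state_add:
  assumes "A \<in> carrier_mat n n" "b \<in> carrier_vec n" "x \<in> carrier_vec n" "y \<in> carrier_vec n"
  shows "driven_state A b (\<lambda>p. u p + w p) (x + y) t = driven_state A b u x t + driven_state A b w y t"
proof (induction t)
  case (Suc t)
  have c: "driven_state A b u x t \<in> carrier_vec n" "driven_state A b w y t \<in> carrier_vec n"
    using assms by auto
  have c': "A *\<^sub>v driven_state A b u x t \<in> carrier_vec n" "A *\<^sub>v driven_state A b w y t \<in> carrier_vec n"
    using c assms by auto
  show ?case
    using assms(1,2) c' Suc
    by (auto simp: mult_add_distrib_mat_vec[OF assms(1) c] algebra_simps)
qed simp

lemma driven_state_smult:
  assumes "A \<in> carrier_mat n n" "b \<in> carrier_vec n" "x \<in> carrier_vec n"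
  shows "driven_state A b (\<lambda>p. c * w p) (c \<cdot>\<^sub>v x) t = c \<cdot>\<^sub>v driven_state A b w x t"
proof (induction t)
  case (Suc t)
  have d: "driven_state A b w x t \<in> carrier_vec n" using assms by auto
  then have d': "A *\<^sub>v driven_state A b w x t \<in> carrier_vec n" using assms by auto
  show ?case
    using assms(1,2) d' Suc by (auto simp: mult_mat_vec[OF assms(1) d] algebra_simps)
qed simp

lemma driven_state_plus_time:
  "driven_state A b w x (s + t) = driven_state A b (\<lambda>p. w (s + p)) (driven_state A b w x s) t"
  by (induction t) auto

lemma driven_state_cong:
  "(\<And>p. p < t \<Longrightarrow> u p = w p) \<Longrightarrow> driven_state A b u x t = driven_state A b w x t"
  by (induction t) auto

lemma driven_state_stays_zero:
  assumes "A \<in> carrier_mat n n" "b \<in> carrier_vec n"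
    and "driven_state A b w x s = 0\<^sub>v n" "\<And>p. p \<ge> s \<Longrightarrow> w p = 0" "s \<le> t"
  shows "driven_state A b w x t = 0\<^sub>v n"
  using assms(5)
proof (induction t rule: dec_induct)
  case (step t)
  then show ?case using assms by auto
qed (use assms in auto)

section \<open>Change of basis and block decomposition\<close>

lemma driven_state_similar:
  assumes "A \<in> carrier_mat n n" "b \<in> carrier_vec n" "x \<in> carrier_vec n"
    and T: "T \<in> carrier_mat n n" and S: "S \<in> carrier_mat n n" and "inverts_mat S T"
  shows "T *\<^sub>v driven_state A b w x t = driven_state (T * A * S) (T *\<^sub>v b) w (T *\<^sub>v x) t"
proof (induction t)
  case (Suc t)
  let ?x = "driven_state A b w x t"
  have x: "?x \<in> carrier_vec n" using assms by auto
  have ST: "S * T = 1\<^sub>m n" using assms unfolding inverts_mat_def by auto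
  have "(T * A * S) *\<^sub>v (T *\<^sub>v ?x) = (T * A * S * T) *\<^sub>v ?x"
    using assms x by (intro assoc_mult_mat_vec[symmetric]) auto
  also have "T * A * S * T = T * A * (S * T)"
    using assms by (intro assoc_mult_mat) auto
  also have "\<dots> = T * A" using assms ST by auto
  also have "(T * A) *\<^sub>v ?x = T *\<^sub>v (A *\<^sub>v ?x)"
    using assms x by (intro assoc_mult_mat_vec) auto
  finally have eq: "(T * A * S) *\<^sub>v (T *\<^sub>v ?x) = T *\<^sub>v (A *\<^sub>v ?x)" .
  have "T *\<^sub>v (A *\<^sub>v ?x + w t \<cdot>\<^sub>v b) = T *\<^sub>v (A *\<^sub>v ?x) + T *\<^sub>v (w t \<cdot>\<^sub>v b)"
    using assms x by (intro mult_add_distrib_mat_vec) auto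
  also have "T *\<^sub>v (w t \<cdot>\<^sub>v b) = w t \<cdot>\<^sub>v (T *\<^sub>v b)"
    using assms by (intro mult_mat_vec) auto
  finally show ?case using eq Suc by simp
qed simp

lemma switched_controllable_similarI:
  assumes "A \<in> carrier_mat n n" "b \<in> carrier_vec n"
    and T: "T \<in> carrier_mat n n" and S: "S \<in> carrier_mat n n"
    and "inverts_mat S T" "inverts_mat T S"
    and con: "switched_controllable n A b D"
  shows "switched_controllable n (T * A * S) (T *\<^sub>v b) D"
  unfolding switched_controllable_iff_driven
proof (intro ballI allI impI)
  fix x0 xf :: "real vec" and \<sigma> :: "nat \<Rightarrow> nat"
  assume x: "x0 \<in> carrier_vec n" "xf \<in> carrier_vec n" and \<sigma>: "range \<sigma> \<subseteq> D"
  have TS: "T *\<^sub>v (S *\<^sub>v x) = x" if "x \<in> carrier_vec n" for x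
  proof -
    have "T *\<^sub>v (S *\<^sub>v x) = (T * S) *\<^sub>v x" using T S that by auto
    also have "T * S = 1\<^sub>m n" using assms unfolding inverts_mat_def by auto
    finally show ?thesis using that by simp
  qed
  \<comment> \<open>Both endpoints are pulled back by \<open>S\<close>; the input that steers
    between them works unchanged in the new coordinates.\<close>
  have "S *\<^sub>v x0 \<in> carrier_vec n" "S *\<^sub>v xf \<in> carrier_vec n" using S x by auto
  then obtain w t where w: "\<forall>p. w p \<noteq> 0 \<longrightarrow> p \<in> arrivals \<sigma>"
      "driven_state A b w (S *\<^sub>v x0) t = S *\<^sub>v xf"
    using con \<sigma> unfolding switched_controllable_iff_driven by meson
  have "driven_state (T * A * S) (T *\<^sub>v b) w (T *\<^sub>v (S *\<^sub>v x0)) t = T *\<^sub>v (S *\<^sub>v xf)"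
    using driven_state_similar[OF assms(1,2) _ T S assms(5), of "S *\<^sub>v x0" w t] w(2) S x by auto
  then show "\<exists>w t. (\<forall>p. w p \<noteq> 0 \<longrightarrow> p \<in> arrivals \<sigma>) \<and>
      driven_state (T * A * S) (T *\<^sub>v b) w x0 t = xf"
    using w(1) TS x by auto
qed

lemma switched_controllable_similar_iff:
  assumes A: "A \<in> carrier_mat n n" and b: "b \<in> carrier_vec n"
    and T: "T \<in> carrier_mat n n" and S: "S \<in> carrier_mat n n"
    and ST: "inverts_mat S T" and TS: "inverts_mat T S"
  shows "switched_controllable n (T * A * S) (T *\<^sub>v b) D \<longleftrightarrow> switched_controllable n A b D"
proof
  assume "switched_controllable n (T * A * S) (T *\<^sub>v b) D"
  \<comment> \<open>The converse is the same implication with \<open>T\<close> and \<open>S\<close>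
    exchanged; the conjugations then cancel.\<close>
  then have "switched_controllable n (S * (T * A * S) * T) (S *\<^sub>v (T *\<^sub>v b)) D"
    by (rule switched_controllable_similarI[OF _ _ S T TS ST, rotated 2]) (use A b S T in auto)
  moreover have id: "S * T = 1\<^sub>m n" using ST S T unfolding inverts_mat_def by auto
  have "S *\<^sub>v (T *\<^sub>v b) = (S * T) *\<^sub>v b" using S T b by auto
  then have "S *\<^sub>v (T *\<^sub>v b) = b" using id b by simp
  moreover have "S * (T * A * S) * T = A"
  proof -
    have "S * (T * A * S) * T = S * (T * A) * S * T"
      using A S T by (subst assoc_mult_mat[of S n n "T * A" n S n]) auto
    also have "\<dots> = S * (T * A) * (S * T)"
      using A S T by (intro assoc_mult_mat) auto
    also have "\<dots> = S * (T * A)" using id A S T by auto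
    also have "\<dots> = S * T * A" using A S T by auto
    finally show ?thesis using id A by simp
  qed
  ultimately show "switched_controllable n A b D" by simp
qed (use assms switched_controllable_similarI in blast)

text \<open>The zero off-diagonal blocks decouple the dynamics, but both components are still driven
  by one scalar input \<open>w\<close>.\<close>

lemma driven_state_block_diag:
  assumes A: "A \<in> carrier_mat k k" and B: "B \<in> carrier_mat m m"
    and "b \<in> carrier_vec k" "c \<in> carrier_vec m" "x \<in> carrier_vec k" "y \<in> carrier_vec m"
  shows "driven_state (four_block_mat A (0\<^sub>m k m) (0\<^sub>m m k) B) (b @\<^sub>v c) w (x @\<^sub>v y) t =
         driven_state A b w x t @\<^sub>v driven_state B c w y t"
proof (induction t)
  case (Suc t)
  let ?x = "driven_state A b w x t" and ?y = "driven_state B c w y t"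
  have c: "?x \<in> carrier_vec k" "?y \<in> carrier_vec m" using assms by auto
  have "four_block_mat A (0\<^sub>m k m) (0\<^sub>m m k) B *\<^sub>v (?x @\<^sub>v ?y) =
        (A *\<^sub>v ?x + 0\<^sub>m k m *\<^sub>v ?y) @\<^sub>v (0\<^sub>m m k *\<^sub>v ?x + B *\<^sub>v ?y)"
    using c A B by (intro four_block_mat_mult_vec) auto
  also have "\<dots> = (A *\<^sub>v ?x) @\<^sub>v (B *\<^sub>v ?y)" using A B c by auto
  finally show ?case
    using Suc assms c by (auto intro!: eq_vecI simp: append_vec_def)
qed simp

section \<open>The nilpotent Jordan block\<close>

lemma jordan_block_0_mult_vec:
  assumes "y \<in> carrier_vec k" "i < k"
  shows "(jordan_block k 0 *\<^sub>v y) $ i = (if Suc i < k then y $ Suc i else (0 :: real))"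
proof -
  have "(jordan_block k 0 *\<^sub>v y) $ i =
      (\<Sum>j<k. (if i = j then 0 else if Suc i = j then 1 else 0) * y $ j)"
    using assms by (simp add: scalar_prod_def jordan_block_def atLeast0LessThan)
  also have "\<dots> = (\<Sum>j<k. if j = Suc i then y $ j else 0)"
    by (rule sum.cong) auto
  finally show ?thesis using assms by (simp add: sum.delta)
qed

text \<open>
  Counting coordinates from the bottom and time backwards turns the zero-state response of a
  nilpotent Jordan block into a convolution.
\<close>

lemma driven_state_jordan_block_0:
  assumes b: "b \<in> carrier_vec k" and y: "y \<in> carrier_vec k" and "j < k"
  shows "driven_state (jordan_block k 0) b w y t $ (k - 1 - j) =
     (if t \<le> j then y $ (k - 1 - (j - t)) else 0) +
     (\<Sum>i\<le>j. (if i < t then w (t - 1 - i) else 0) * b $ (k - 1 - (j - i)))"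
  using \<open>j < k\<close>
proof (induction t arbitrary: j)
  case (Suc t)
  let ?x = "driven_state (jordan_block k 0) b w y t"
  have x: "?x \<in> carrier_vec k" using b y by (intro driven_state_carrier) auto
  have "driven_state (jordan_block k 0) b w y (Suc t) $ (k - 1 - j) =
      (jordan_block k 0 *\<^sub>v ?x) $ (k - 1 - j) + w t * b $ (k - 1 - j)"
    using Suc.prems b by simp
  also have "(jordan_block k 0 *\<^sub>v ?x) $ (k - 1 - j) =
      (if Suc (k - 1 - j) < k then ?x $ Suc (k - 1 - j) else 0)"
    using Suc.prems x by (intro jordan_block_0_mult_vec) auto
  finally have step: "driven_state (jordan_block k 0) b w y (Suc t) $ (k - 1 - j) =
      (if Suc (k - 1 - j) < k then ?x $ Suc (k - 1 - j) else 0) + w t * b $ (k - 1 - j)" .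
  show ?case
  proof (cases j)
    case 0
    then show ?thesis using step Suc.prems by simp
  next
    case (Suc j')
    have "Suc (k - 1 - j) = k - 1 - j'" "Suc (k - 1 - j) < k" using Suc Suc.prems by auto
    \<comment> \<open>The block shifts coordinates up by one place. Hence the term for
      \<open>i = 0\<close> is the newest input, and the remaining terms are the response one step
      earlier in the coordinate just below.\<close>
    moreover have "(\<Sum>i\<le>j'. (if Suc i < Suc t then w (Suc t - 1 - Suc i) else 0) *
        b $ (k - 1 - (Suc j' - Suc i))) =
      (\<Sum>i\<le>j'. (if i < t then w (t - 1 - i) else 0) * b $ (k - 1 - (j' - i)))"
      by (intro sum.cong) auto
    ultimately show ?thesis
      using step Suc.IH[of j'] Suc.prems unfolding Suc sum.atMost_Suc_shift
      by (simp del: driven_state.simps)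
  qed
qed simp

text \<open>The truncated convolution is a triangular system with \<open>\<beta> 0\<close> on the
  diagonal, solved by forward substitution.\<close>

lemma convolution_cancel:
  fixes d e \<beta> :: "nat \<Rightarrow> real"
  assumes "\<beta> 0 \<noteq> 0"
    and "\<And>j. j < k \<Longrightarrow> (\<Sum>i\<le>j. d i * \<beta> (j - i)) = (\<Sum>i\<le>j. e i * \<beta> (j - i))"
  shows "j < k \<Longrightarrow> d j = e j"
proof (induction j rule: less_induct)
  case (less j)
  have "(\<Sum>i<j. d i * \<beta> (j - i)) = (\<Sum>i<j. e i * \<beta> (j - i))"
    using less by (intro sum.cong) auto
  moreover have "(\<Sum>i\<le>j. f i) = (\<Sum>i<j. f i) + f j" for f :: "nat \<Rightarrow> real"
    by (simp flip: lessThan_Suc_atMost)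
  ultimately show ?case using assms(1) assms(2)[OF less.prems] by simp
qed

text \<open>The bottom coordinate receives nothing from the others, so if the last entry of
  \<open>b\<close> were 0 it would stay 0 when started at 0.\<close>

lemma jordan_block_0_controllable_last_nonzero:
  assumes "switched_controllable k (jordan_block k 0) b D" "b \<in> carrier_vec k" "k \<ge> 1" "D \<noteq> {}"
  shows "b $ (k - 1) \<noteq> 0"
proof
  assume b0: "b $ (k - 1) = 0"
  \<comment> \<open>A constant signal serves as test case; for empty \<open>D\<close> there is no
    signal, and controllability would hold vacuously.\<close>
  obtain \<delta> where "\<delta> \<in> D" using assms by blast
  then have "range (\<lambda>_ :: nat. \<delta>) \<subseteq> D" by auto
  then obtain w t where w: "driven_state (jordan_block k 0) b w (0\<^sub>v k) t = unit_vec k (k - 1)"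
    using assms(1) unfolding switched_controllable_iff_driven
    by (meson unit_vec_carrier zero_carrier_vec)
  have "driven_state (jordan_block k 0) b w (0\<^sub>v k) t $ (k - 1) = 0"
    using driven_state_jordan_block_0[OF assms(2), of "0\<^sub>v k" 0 w t] assms(3) b0 by simp
  then show False using w assms(3) by simp
qed

text \<open>The target is chosen so that reaching it requires the last \<open>k\<close> inputs to be all \<open>1\<close>.\<close>

lemma jordan_block_0_controllable_window:
  assumes con: "switched_controllable k (jordan_block k 0) b D" and b: "b \<in> carrier_vec k"
    and "k \<ge> 1" and \<sigma>: "range \<sigma> \<subseteq> D"
  shows "\<exists>s. \<forall>i<k. s + i \<in> arrivals \<sigma>"
proof -
  define \<beta> where "\<beta> l = b $ (k - 1 - l)" for l
  have "\<beta> 0 \<noteq> 0"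
    using jordan_block_0_controllable_last_nonzero[OF con b] assms \<sigma> unfolding \<beta>_def by fastforce
  \<comment> \<open>This is the response, read from the bottom, to the constant input 1.\<close>
  define xf where "xf = vec k (\<lambda>r. \<Sum>i\<le>k - 1 - r. 1 * \<beta> (k - 1 - r - i))"
  have "xf \<in> carrier_vec k" by (simp add: xf_def)
  then obtain w t where w: "\<And>p. w p \<noteq> 0 \<Longrightarrow> p \<in> arrivals \<sigma>"
      "driven_state (jordan_block k 0) b w (0\<^sub>v k) t = xf"
    using con \<sigma> unfolding switched_controllable_iff_driven by (meson zero_carrier_vec)
  \<comment> \<open>The input read backwards from the final time, padded with 0 for times before the
    start.\<close>
  define d where "d i = (if i < t then w (t - 1 - i) else 0)" for i
  have "(\<Sum>i\<le>j. d i * \<beta> (j - i)) = (\<Sum>i\<le>j. 1 * \<beta> (j - i))" if "j < k" for j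
  proof -
    have "xf $ (k - 1 - j) = (\<Sum>i\<le>j. 1 * \<beta> (j - i))" using that by (simp add: xf_def)
    moreover have "driven_state (jordan_block k 0) b w (0\<^sub>v k) t $ (k - 1 - j) =
        (\<Sum>i\<le>j. d i * \<beta> (j - i))"
      using driven_state_jordan_block_0[OF b _ that, of "0\<^sub>v k" w t] that
      by (simp add: d_def \<beta>_def split: if_splits)
    ultimately show ?thesis using w(2) by simp
  qed
  from convolution_cancel[of \<beta> k d "\<lambda>_. 1", OF \<open>\<beta> 0 \<noteq> 0\<close> this]
  have d: "d i = 1" if "i < k" for i using that by blast
  have "d (k - 1) \<noteq> 0" using d assms by simp
  \<comment> \<open>The padding begins at index \<open>t\<close>, so a nonzero
    \<open>d (k - 1)\<close> forces \<open>t\<close> to be at least \<open>k\<close>; the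
    subtraction \<open>t - k\<close> below is then exact.\<close>
  then have "k \<le> t" using assms(3) by (auto simp: d_def split: if_splits)
  have "t - k + i \<in> arrivals \<sigma>" if "i < k" for i
  proof -
    have "d (k - 1 - i) = 1" using d that by simp
    moreover have "t - 1 - (k - 1 - i) = t - k + i" "k - 1 - i < t" using that \<open>k \<le> t\<close> by auto
    ultimately show ?thesis using w(1)[of "t - k + i"] by (simp add: d_def)
  qed
  then show ?thesis by blast
qed

text \<open>After \<open>k\<close> steps nilpotency has erased the initial state and only the last
  \<open>k\<close> inputs count, so one input sequence serves all \<open>y\<close>. Its support is
  not restricted here; it is placed inside a window of arrivals later.\<close>

lemma jordan_block_0_deadbeat:
  assumes con: "switched_controllable k (jordan_block k 0) b D" and b: "b \<in> carrier_vec k"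
    and "D \<noteq> {}" and yf: "yf \<in> carrier_vec k"
  obtains c where "\<And>y. y \<in> carrier_vec k \<Longrightarrow> driven_state (jordan_block k 0) b c y k = yf"
proof -
  obtain \<delta> where "\<delta> \<in> D" using assms by blast
  then have "range (\<lambda>_ :: nat. \<delta>) \<subseteq> D" by auto
  then obtain w t where w: "driven_state (jordan_block k 0) b w (0\<^sub>v k) t = yf"
    using con yf unfolding switched_controllable_iff_driven by (meson zero_carrier_vec)
  \<comment> \<open>\<open>c\<close> replays the last \<open>k\<close> inputs of a run from 0 to
    \<open>yf\<close>. If that run is shorter than \<open>k\<close>, zeros are put in front, which
    keeps the state at 0.\<close>
  define c where "c p = (if k - 1 - p < t then w (t - 1 - (k - 1 - p)) else 0)" for p
  have "driven_state (jordan_block k 0) b c y k = yf" if y: "y \<in> carrier_vec k" for y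
  proof (rule eq_vecI)
    show "dim_vec (driven_state (jordan_block k 0) b c y k) = dim_vec yf"
      using driven_state_carrier[of "jordan_block k 0" k b y c k] b y yf by auto
    fix r assume "r < dim_vec yf"
    then have r: "r < k" using yf by auto
    define j where "j = k - 1 - r"
    have j: "j < k" "r = k - 1 - j" using r by (auto simp: j_def)
    have "driven_state (jordan_block k 0) b c y k $ r =
        (\<Sum>i\<le>j. (if i < t then w (t - 1 - i) else 0) * b $ (k - 1 - (j - i)))"
      using driven_state_jordan_block_0[OF b y j(1), of c k] j
      by (auto simp: c_def intro!: sum.cong)
    also have "\<dots> = yf $ r"
      using driven_state_jordan_block_0[OF b _ j(1), of "0\<^sub>v k" w t] w j by auto
    finally show "driven_state (jordan_block k 0) b c y k $ r = yf $ r" .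
  qed
  then show ?thesis using that by blast
qed

section \<open>The invertible block\<close>

text \<open>The unforced motion can be run backwards by the inverse of \<open>A\<close>. This turns
  a prescribed correction of the final state into one of the initial state.\<close>

lemma invertible_free_state_surj:
  assumes A: "A \<in> carrier_mat m m" and "invertible_mat A" and b: "b \<in> carrier_vec m"
    and "q \<in> carrier_vec m"
  shows "\<exists>z \<in> carrier_vec m. driven_state A b (\<lambda>_. 0) z t = q"
  using assms(4)
proof (induction t arbitrary: q)
  case (Suc t)
  obtain B where B: "inverts_mat A B" "inverts_mat B A"
    using assms(2) unfolding invertible_mat_def by blast
  have AB: "A * B = 1\<^sub>m m" using B(1) A unfolding inverts_mat_def by auto
  \<comment> \<open>The size of \<open>B\<close> is read off from its two products with
    \<open>A\<close>.\<close>
  have "dim_row B = m"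
    using B(2) A unfolding inverts_mat_def
    by (metis carrier_matD(2) index_mult_mat(3) index_one_mat(3))
  moreover have "dim_col B = m" using AB by (metis index_mult_mat(3) index_one_mat(3))
  ultimately have Bc: "B \<in> carrier_mat m m" by auto
  then have "B *\<^sub>v q \<in> carrier_vec m" using Suc.prems by auto
  then obtain z where z: "z \<in> carrier_vec m" "driven_state A b (\<lambda>_. 0) z t = B *\<^sub>v q"
    using Suc.IH by blast
  have "A *\<^sub>v (B *\<^sub>v q) = (A * B) *\<^sub>v q" using A Bc Suc.prems by auto
  then have "driven_state A b (\<lambda>_. 0) z (Suc t) = q" using z AB Suc.prems b A by auto
  then show ?case using z(1) by blast
qed simp

text \<open>By linearity it suffices to steer the finitely many unit vectors to 0; the maximum of
  their times works for every state because 0 is kept once inputs stop.\<close>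

lemma controllable_uniform_null_time:
  assumes con: "switched_controllable m A b D" and A: "A \<in> carrier_mat m m"
    and b: "b \<in> carrier_vec m" and \<sigma>: "range \<sigma> \<subseteq> D"
  obtains s where "\<And>z. z \<in> carrier_vec m \<Longrightarrow> \<exists>w.
      (\<forall>p. w p \<noteq> 0 \<longrightarrow> p \<in> arrivals \<sigma> \<and> p < s) \<and> (\<forall>t\<ge>s. driven_state A b w z t = 0\<^sub>v m)"
proof -
  \<comment> \<open>Induction on the number \<open>j\<close> of leading coordinates that may be
    nonzero.\<close>
  have "\<exists>s. \<forall>z\<in>carrier_vec m. (\<forall>i. j \<le> i \<and> i < m \<longrightarrow> z $ i = 0) \<longrightarrow> (\<exists>w.
      (\<forall>p. w p \<noteq> 0 \<longrightarrow> p \<in> arrivals \<sigma> \<and> p < s) \<and> (\<forall>t\<ge>s. driven_state A b w z t = 0\<^sub>v m))"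
    if "j \<le> m" for j
    using that
  proof (induction j)
    case 0
    have "driven_state A b (\<lambda>_. 0) (0\<^sub>v m) t = 0\<^sub>v m" for t
      by (rule driven_state_stays_zero[OF A b, where s = 0]) auto
    moreover have "z = 0\<^sub>v m" if "z \<in> carrier_vec m" "\<forall>i. 0 \<le> i \<and> i < m \<longrightarrow> z $ i = 0" for z :: "real vec"
      using that by (intro eq_vecI) auto
    ultimately show ?case by (intro exI[of _ 0] ballI impI exI[of _ "\<lambda>_. 0"]) simp
  next
    case (Suc j)
    let ?e = "unit_vec m j"
    obtain s where s: "\<And>z. z \<in> carrier_vec m \<Longrightarrow> (\<forall>i. j \<le> i \<and> i < m \<longrightarrow> z $ i = 0) \<Longrightarrow> \<exists>w.
      (\<forall>p. w p \<noteq> 0 \<longrightarrow> p \<in> arrivals \<sigma> \<and> p < s) \<and> (\<forall>t\<ge>s. driven_state A b w z t = 0\<^sub>v m)"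
      using Suc.IH[OF Suc_leD[OF Suc.prems]] by (elim exE) blast
    obtain u' r where u': "\<And>p. u' p \<noteq> 0 \<Longrightarrow> p \<in> arrivals \<sigma>" "driven_state A b u' ?e r = 0\<^sub>v m"
      using con \<sigma> unfolding switched_controllable_iff_driven
      by (meson unit_vec_carrier zero_carrier_vec)
    \<comment> \<open>Inputs after \<open>r\<close> are cut off, so that the zero state reached at
      \<open>r\<close> persists.\<close>
    define u where "u p = (if p < r then u' p else 0)" for p
    have "driven_state A b u ?e r = 0\<^sub>v m"
      using u'(2) driven_state_cong[of r u u' A b ?e] by (simp add: u_def)
    then have u: "driven_state A b u ?e t = 0\<^sub>v m" if "t \<ge> r" for t
      using driven_state_stays_zero[OF A b _ _ that, of u ?e] by (simp add: u_def)
    show ?case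
    proof (intro exI[of _ "max s r"] ballI impI)
      fix z :: "real vec"
      assume z: "z \<in> carrier_vec m" "\<forall>i. Suc j \<le> i \<and> i < m \<longrightarrow> z $ i = 0"
      define y where "y = vec m (\<lambda>i. if i < j then z $ i else 0)"
      have y: "y \<in> carrier_vec m" "\<forall>i. j \<le> i \<and> i < m \<longrightarrow> y $ i = 0" by (auto simp: y_def)
      have zy: "z = y + z $ j \<cdot>\<^sub>v ?e"
        using z Suc.prems by (intro eq_vecI) (auto simp: y_def not_less_eq unit_vec_def)
      obtain w where w: "\<And>p. w p \<noteq> 0 \<Longrightarrow> p \<in> arrivals \<sigma> \<and> p < s"
          "\<And>t. t \<ge> s \<Longrightarrow> driven_state A b w y t = 0\<^sub>v m"
        using s[OF y] by blast
      let ?w = "\<lambda>p. w p + z $ j * u p"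
      have "driven_state A b ?w z t = 0\<^sub>v m" if "t \<ge> max s r" for t
      proof -
        have "driven_state A b ?w (y + z $ j \<cdot>\<^sub>v ?e) t =
            driven_state A b w y t + z $ j \<cdot>\<^sub>v driven_state A b u ?e t"
          using A b y by (subst driven_state_add[of A m]) (auto simp: driven_state_smult[of A m])
        then show ?thesis using w(2) u that zy by auto
      qed
      moreover have "p \<in> arrivals \<sigma> \<and> p < max s r" if "?w p \<noteq> 0" for p
        using that w(1)[of p] u'(1)[of p] by (cases "w p = 0") (auto simp: u_def split: if_splits)
      ultimately show "\<exists>w. (\<forall>p. w p \<noteq> 0 \<longrightarrow> p \<in> arrivals \<sigma> \<and> p < max s r) \<and>
          (\<forall>t\<ge>max s r. driven_state A b w z t = 0\<^sub>v m)"
        by (intro exI[of _ ?w]) auto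
    qed
  qed
  from this[of m] show ?thesis using that by (metis leD order_refl)
qed

section \<open>Combining the two blocks\<close>

lemma arrivals_shift:
  assumes "p \<in> arrivals (\<lambda>t. \<sigma> (s + t))"
  shows "s + p \<in> arrivals \<sigma>"
  using assms unfolding arrivals_def by (auto simp: image_iff) (metis add.assoc)

lemma switched_controllable_block_diag_iff:
  fixes B :: "real mat"
  defines "J k \<equiv> jordan_block k 0"
  assumes "k \<ge> 1" and B: "B \<in> carrier_mat m m" and inv: "invertible_mat B"
    and b: "b \<in> carrier_vec k" and c: "c \<in> carrier_vec m"
  shows "switched_controllable (k + m) (four_block_mat (J k) (0\<^sub>m k m) (0\<^sub>m m k) B) (b @\<^sub>v c) D \<longleftrightarrow>
         switched_controllable k (J k) b D \<and> switched_controllable m B c D"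
    (is "?L \<longleftrightarrow> ?R")
proof -
  have J: "J k \<in> carrier_mat k k" by (simp add: J_def)
  note block = driven_state_block_diag[OF J B b c]
  note car = driven_state_carrier[OF J b] driven_state_carrier[OF B c]
  show ?thesis
  proof
    assume L: ?L
    have reach: "\<exists>w t. (\<forall>p. w p \<noteq> 0 \<longrightarrow> p \<in> arrivals \<sigma>) \<and>
        driven_state (J k) b w y0 t = yf \<and> driven_state B c w z0 t = zf"
      if y: "y0 \<in> carrier_vec k" "yf \<in> carrier_vec k" and z: "z0 \<in> carrier_vec m" "zf \<in> carrier_vec m"
        and \<sigma>: "range \<sigma> \<subseteq> D" for y0 yf z0 zf and \<sigma> :: "nat \<Rightarrow> nat"
    proof -
      have "y0 @\<^sub>v z0 \<in> carrier_vec (k + m)" "yf @\<^sub>v zf \<in> carrier_vec (k + m)" using y z by auto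
      then obtain w t where w: "\<forall>p. w p \<noteq> 0 \<longrightarrow> p \<in> arrivals \<sigma>"
        "driven_state (J k) b w y0 t @\<^sub>v driven_state B c w z0 t = yf @\<^sub>v zf"
        using L \<sigma> block y z unfolding switched_controllable_iff_driven by metis
      then have "driven_state (J k) b w y0 t = yf" "driven_state B c w z0 t = zf"
        using append_vec_eq[OF car(1)[OF y(1)] y(2)] by auto
      then show ?thesis using w(1) by blast
    qed
    \<comment> \<open>Each block is controlled by letting the other one start and end at 0.\<close>
    show ?R
      unfolding switched_controllable_iff_driven
      using reach[OF _ _ zero_carrier_vec zero_carrier_vec]
        reach[OF zero_carrier_vec zero_carrier_vec] by meson
  next
    assume R: ?R
    show ?L
      unfolding switched_controllable_iff_driven
    proof (intro ballI allI impI)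
      fix x0 xf :: "real vec" and \<sigma> :: "nat \<Rightarrow> nat"
      assume x0: "x0 \<in> carrier_vec (k + m)" and xf: "xf \<in> carrier_vec (k + m)" and \<sigma>: "range \<sigma> \<subseteq> D"
      obtain y0 z0 where x0_eq: "x0 = y0 @\<^sub>v z0" and y0: "y0 \<in> carrier_vec k" and z0: "z0 \<in> carrier_vec m"
        using vec_first_last_append[OF x0]
        by (intro that[of "vec_first x0 k" "vec_last x0 m"]) auto
      obtain yf zf where xf_eq: "xf = yf @\<^sub>v zf" and yf: "yf \<in> carrier_vec k" and zf: "zf \<in> carrier_vec m"
        using vec_first_last_append[OF xf]
        by (intro that[of "vec_first xf k" "vec_last xf m"]) auto
      have "D \<noteq> {}" using \<sigma> by auto
      \<comment> \<open>The state steered to 0 below depends on the window, and the window is sought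
        only after \<open>s\<close>. Uniformity of \<open>s\<close> in the state avoids this
        circularity.\<close>
      obtain s where s: "\<And>z. z \<in> carrier_vec m \<Longrightarrow> \<exists>w.
          (\<forall>p. w p \<noteq> 0 \<longrightarrow> p \<in> arrivals \<sigma> \<and> p < s) \<and> (\<forall>t\<ge>s. driven_state B c w z t = 0\<^sub>v m)"
        using controllable_uniform_null_time[OF conjunct2[OF R] B c \<sigma>] by blast
      have "range (\<lambda>t. \<sigma> (s + t)) \<subseteq> D" using \<sigma> by auto
      then obtain r where r: "\<And>i. i < k \<Longrightarrow> r + i \<in> arrivals (\<lambda>t. \<sigma> (s + t))"
        using jordan_block_0_controllable_window[of k b D "\<lambda>t. \<sigma> (s + t)"] R b \<open>k \<ge> 1\<close>
        unfolding J_def by blast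
      obtain a where a: "\<And>y. y \<in> carrier_vec k \<Longrightarrow> driven_state (J k) b a y k = yf"
        using jordan_block_0_deadbeat[of k b D yf] R b \<open>D \<noteq> {}\<close> yf unfolding J_def by blast
      define h where "h = s + r"
      define u where "u p = (if h \<le> p \<and> p < h + k then a (p - h) else 0)" for p
      let ?t = "h + k"
      have u_arr: "p \<in> arrivals \<sigma>" if "u p \<noteq> 0" for p
      proof -
        have "h \<le> p" "p < h + k" using that by (auto simp: u_def split: if_splits)
        then have "s + (r + (p - h)) \<in> arrivals \<sigma>" by (intro arrivals_shift r) auto
        then show ?thesis using \<open>h \<le> p\<close> by (simp add: h_def)
      qed
      \<comment> \<open>The side effect of the window inputs on the invertible component.\<close>
      let ?zu = "driven_state B c u (0\<^sub>v m) ?t"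
      have zu: "?zu \<in> carrier_vec m" by (intro car) auto
      then obtain z where z: "z \<in> carrier_vec m" "driven_state B c (\<lambda>_. 0) z ?t = zf - ?zu"
        using invertible_free_state_surj[OF B inv c, of "zf - ?zu" ?t] zf by auto
      \<comment> \<open>Cancelling \<open>z0 - z\<close> before \<open>s\<close> makes the
        trajectory from \<open>z0\<close> coincide from then on with the free motion of
        \<open>z\<close>, which ends at \<open>zf - ?zu\<close>.\<close>
      obtain w where w: "\<And>p. w p \<noteq> 0 \<Longrightarrow> p \<in> arrivals \<sigma> \<and> p < s"
          "\<And>t. t \<ge> s \<Longrightarrow> driven_state B c w (z0 - z) t = 0\<^sub>v m"
        using s[OF minus_carrier_vec[OF z0 z(1)]] by blast
      let ?w = "\<lambda>p. w p + u p"
      have "driven_state (J k) b ?w y0 ?t =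
          driven_state (J k) b (\<lambda>p. ?w (h + p)) (driven_state (J k) b ?w y0 h) k"
        by (rule driven_state_plus_time)
      also have "\<dots> = driven_state (J k) b a (driven_state (J k) b ?w y0 h) k"
      proof (rule driven_state_cong)
        fix p assume "p < k"
        \<comment> \<open>\<open>w\<close> is silent from \<open>s\<close> on, hence throughout the
          window starting at \<open>h\<close>.\<close>
        moreover have "w (h + p) = 0" using w(1)[of "h + p"] by (auto simp: h_def)
        ultimately show "?w (h + p) = a p" by (simp add: u_def)
      qed
      also have "\<dots> = yf" by (intro a car y0)
      finally have yt: "driven_state (J k) b ?w y0 ?t = yf" .
      have w0: "driven_state B c w z0 ?t = zf - ?zu"
      proof -
        have "z0 = (z0 - z) + z" using z0 z by (intro eq_vecI) auto
        then have "driven_state B c w z0 ?t =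
            driven_state B c (\<lambda>p. w p + (\<lambda>_. 0) p) ((z0 - z) + z) ?t" by simp
        also have "\<dots> = driven_state B c w (z0 - z) ?t + driven_state B c (\<lambda>_. 0) z ?t"
          using z0 z by (intro driven_state_add[OF B c]) auto
        also have "\<dots> = zf - ?zu" using w(2)[of ?t] z zf zu by (auto simp: h_def)
        finally show ?thesis .
      qed
      have "driven_state B c ?w (z0 + 0\<^sub>v m) ?t = driven_state B c w z0 ?t + ?zu"
        using z0 by (intro driven_state_add[OF B c]) auto
      also have "\<dots> = zf" unfolding w0 using zf zu by (intro eq_vecI) auto
      finally have "driven_state B c ?w z0 ?t = zf" using z0 by simp
      then have "driven_state (four_block_mat (J k) (0\<^sub>m k m) (0\<^sub>m m k) B) (b @\<^sub>v c) ?w x0 ?t = xf"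
        by (simp only: x0_eq xf_eq block[OF y0 z0] yt)
      moreover have "\<forall>p. ?w p \<noteq> 0 \<longrightarrow> p \<in> arrivals \<sigma>"
        by (intro allI impI) (metis w(1) u_arr add_0)
      ultimately show "\<exists>w t. (\<forall>p. w p \<noteq> 0 \<longrightarrow> p \<in> arrivals \<sigma>) \<and>
          driven_state (four_block_mat (J k) (0\<^sub>m k m) (0\<^sub>m m k) B) (b @\<^sub>v c) w x0 t = xf"
        by (intro exI[of _ ?w] exI[of _ ?t] conjI)
    qed
  qed
qed

theorem lemma2:
  fixes A T Tinv A' :: "real mat" and b b0 b' :: "real vec" and D :: "nat set" and n k m :: nat
  assumes "A \<in> carrier_mat n n" and "b \<in> carrier_vec n" and "finite D"
    and "T \<in> carrier_mat n n" and "Tinv \<in> carrier_mat n n"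
    and "inverts_mat T Tinv" and "inverts_mat Tinv T"
    and "k \<ge> 1"
    and "A' \<in> carrier_mat m m" and "invertible_mat A'"
    and "b0 \<in> carrier_vec k" and "b' \<in> carrier_vec m"
    and "T * A * Tinv = four_block_mat (jordan_block k 0) (0\<^sub>m k m) (0\<^sub>m m k) A'"
    and "T *\<^sub>v b = b0 @\<^sub>v b'"
  shows "\<not> switched_controllable n A b D \<longleftrightarrow>
         \<not> switched_controllable k (jordan_block k 0) b0 D \<or>
         \<not> switched_controllable m A' b' D"
proof -
  let ?M = "four_block_mat (jordan_block k 0) (0\<^sub>m k m) (0\<^sub>m m k) A'"
  \<comment> \<open>The relation \<open>n = k + m\<close> comes from comparing the lengths of
    \<open>T *\<^sub>v b\<close> and its two pieces.\<close>
  have "T *\<^sub>v b \<in> carrier_vec n" using \<open>T \<in> carrier_mat n n\<close> \<open>b \<in> carrier_vec n\<close> by simp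
  then have "dim_vec (T *\<^sub>v b) = n" by (rule carrier_vecD)
  then have n: "n = k + m"
    unfolding \<open>T *\<^sub>v b = b0 @\<^sub>v b'\<close> using \<open>b0 \<in> carrier_vec k\<close> \<open>b' \<in> carrier_vec m\<close> by simp
  have "switched_controllable n A b D \<longleftrightarrow> switched_controllable n ?M (b0 @\<^sub>v b') D"
    using switched_controllable_similar_iff[of A n b T Tinv D] assms by simp
  also have "\<dots> \<longleftrightarrow> switched_controllable k (jordan_block k 0) b0 D \<and> switched_controllable m A' b' D"
    unfolding n using assms by (intro switched_controllable_block_diag_iff)
  finally show ?thesis by blast
qed

end
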